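(* Let $(W,S)$ be a Coxeter system and $(X,\mathrm{ht})$ a scaled $W$-set, with even double cover $(\tilde X,\widetilde{\mathrm{ht}})$. Then $(\tilde X,\widetilde{\mathrm{ht}})$ is an even scaled $W\times A_1$-set, and it is quasiparabolic (as a $W\times A_1$-set) if and only if $(X,\mathrm{ht})$ is quasiparabolic (as a $W$-set).
   Context: Coxeter systems $(W,S)$ have finite rank; $R(W)$ is the set of reflections, i.e. conjugates in $W$ of elements of $S$; $\ell$ is the length function. A product $W\times W'$ of Coxeter groups is a Coxeter group with simple reflections $S\sqcup S'$. A scaled $W$-set is a pair $(X,\mathrm{ht})$ with $X$ a (left) $W$-set and $\mathrm{ht}:X\to\mathbb Z$ a function with $|\mathrm{ht}(sx)-\mathrm{ht}(x)|\le 1$ for all $s\in S$, $x\in X$. A quasiparabolic $W$-set is a scaled $W$-set such that (QP1) for all $r\in R(W)$, $x\in X$, if $\mathrm{ht}(rx)=\mathrm{ht}(x)$ then $rx=x$; and (QP2) for all $r\in R(W)$, $x\in X$, $s\in S$, if $\mathrm{ht}(rx)>\mathrm{ht}(x)$ and $\mathrm{ht}(srx)<\mathrm{ht}(sx)$, then $rx=sx$. A scaled $W$-set is even if $wx=x$ ($w\in W$, $x\in X$) implies that $\ell(w)$ is even. Even double cover: let $A_1=\langle s_0\rangle$ be the Coxeter group of order 2. As a set $\tilde X=X\times\mathbb F_2$, with $W$-action $w(x,k)=(wx,k+\ell(w))$ and $A_1$-action $s_0(x,k)=(x,k+1)$; the height is $\widetilde{\mathrm{ht}}(x,k)=\mathrm{ht}(x)$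 if $\mathrm{ht}(x)\equiv k\pmod 2$, and $\widetilde{\mathrm{ht}}(x,k)=\mathrm{ht}(x)+1$ if $\mathrm{ht}(x)\equiv k+1\pmod 2$. *)

theory Defs
  imports "HOL-Algebra.Group_Action" "HOL-Algebra.Elementary_Groups" "HOL-Library.Z2"
begin

section \<open>Coxeter systems\<close>

text \<open>A Coxeter matrix on \<open>S\<close>; the entry \<open>0\<close> encodes \<open>m(s,t) = \<infinity>\<close> (no relation).\<close>

definition coxeter_matrix :: "'a set \<Rightarrow> ('a \<Rightarrow> 'a \<Rightarrow> nat) \<Rightarrow> bool" where
  "coxeter_matrix S m \<longleftrightarrow>
     (\<forall>s\<in>S. m s s = 1) \<and>
     (\<forall>s\<in>S. \<forall>t\<in>S. s \<noteq> t \<longrightarrow> m s t = m t s \<and> m s t \<noteq> 1)"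

text \<open>
  The congruence on the free monoid of words over \<open>S\<close> generated by the relations
  \<open>(st)\<^bsup>m(s,t)\<^esup> = 1\<close>. As \<open>m(s,s) = 1\<close>, the relations \<open>ss = 1\<close> are among them, so the
  quotient monoid is already the group presented by these relations, and inverse letters
  are not needed.
\<close>

inductive coxeter_cong :: "'a set \<Rightarrow> ('a \<Rightarrow> 'a \<Rightarrow> nat) \<Rightarrow> 'a list \<Rightarrow> 'a list \<Rightarrow> bool"
  for S m where
  relation: "s \<in> S \<Longrightarrow> t \<in> S \<Longrightarrow> coxeter_cong S m (concat (replicate (m s t) [s, t])) []"
| refl: "u \<in> lists S \<Longrightarrow> coxeter_cong S m u u"
| sym: "coxeter_cong S m u v \<Longrightarrow> coxeter_cong S m v u"
| trans: "coxeter_cong S m u v \<Longrightarrow> coxeter_cong S m v w \<Longrightarrow> coxeter_cong S m u w"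
| append: "coxeter_cong S m u u' \<Longrightarrow> coxeter_cong S m v v' \<Longrightarrow> coxeter_cong S m (u @ v) (u' @ v')"

definition word_prod :: "('a, 'b) monoid_scheme \<Rightarrow> 'a list \<Rightarrow> 'a" where
  "word_prod G u = foldr (\<lambda>x y. x \<otimes>\<^bsub>G\<^esub> y) u \<one>\<^bsub>G\<^esub>"

locale coxeter_system = group W for W (structure) +
  fixes S
  assumes finite_rank: "finite S"
    and simple_closed: "S \<subseteq> carrier W"
    and generated: "generate W S = carrier W"
    and presentation: "\<exists>m. coxeter_matrix S m \<and>
          (\<forall>u\<in>lists S. \<forall>v\<in>lists S. word_prod W u = word_prod W v \<longleftrightarrow> coxeter_cong S m u v)"

definition cox_length :: "('a, 'b) monoid_scheme \<Rightarrow> 'a set \<Rightarrow> 'a \<Rightarrow> nat" where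
  "cox_length W S w = (LEAST n. \<exists>u\<in>lists S. length u = n \<and> word_prod W u = w)"

definition reflections :: "('a, 'b) monoid_scheme \<Rightarrow> 'a set \<Rightarrow> 'a set" where
  "reflections W S = {w \<otimes>\<^bsub>W\<^esub> s \<otimes>\<^bsub>W\<^esub> inv\<^bsub>W\<^esub> w | w s. w \<in> carrier W \<and> s \<in> S}"

text \<open>The simple reflections \<open>S \<squnion> S'\<close> of \<open>W \<times> W'\<close>.\<close>

definition simple_prod ::
  "('a, 'b) monoid_scheme \<Rightarrow> 'a set \<Rightarrow> ('c, 'd) monoid_scheme \<Rightarrow> 'c set \<Rightarrow> ('a \<times> 'c) set" where
  "simple_prod W S W' S' = (\<lambda>s. (s, \<one>\<^bsub>W'\<^esub>)) ` S \<union> (\<lambda>s'. (\<one>\<^bsub>W\<^esub>, s')) ` S'"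


section \<open>Scaled and quasiparabolic sets\<close>

text \<open>The \<open>W\<close>-set is \<open>X\<close> with \<open>w x = \<phi> w x\<close>; \<open>ht\<close> is only relevant on \<open>X\<close>.\<close>

locale scaled_set = coxeter_system W S + group_action W X \<phi>
  for W (structure) and S and X :: "'x set" and \<phi> +
  fixes ht :: "'x \<Rightarrow> int"
  assumes scaled: "s \<in> S \<Longrightarrow> x \<in> X \<Longrightarrow> \<bar>ht (\<phi> s x) - ht x\<bar> \<le> 1"

locale even_scaled_set = scaled_set +
  assumes even_stabilizer: "w \<in> carrier W \<Longrightarrow> x \<in> X \<Longrightarrow> \<phi> w x = x \<Longrightarrow> even (cox_length W S w)"

locale quasiparabolic_set = scaled_set +
  assumes QP1: "r \<in> reflections W S \<Longrightarrow> x \<in> X \<Longrightarrow> ht (\<phi> r x) = ht x \<Longrightarrow> \<phi> r x = x"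
    and QP2: "r \<in> reflections W S \<Longrightarrow> x \<in> X \<Longrightarrow> s \<in> S \<Longrightarrow>
          ht (\<phi> r x) > ht x \<Longrightarrow> ht (\<phi> s (\<phi> r x)) < ht (\<phi> s x) \<Longrightarrow> \<phi> r x = \<phi> s x"


section \<open>The even double cover\<close>

text \<open>\<open>A\<^sub>1\<close> is realised as the additive group \<open>\<int>/2 = {0, 1}\<close>, with \<open>s\<^sub>0 = 1\<close>.\<close>

abbreviation A1 :: "int monoid" where
  "A1 \<equiv> integer_mod_group 2"

abbreviation s0 :: int where
  "s0 \<equiv> 1"

definition dc_carrier :: "'x set \<Rightarrow> ('x \<times> bit) set" where
  "dc_carrier X = X \<times> UNIV"

text \<open>
  The element \<open>(w, a)\<close> of \<open>W \<times> A\<^sub>1\<close> is \<open>w s\<^sub>0\<^bsup>a\<^esup>\<close>, and \<open>s\<^sub>0\<close> acts by \<open>(x, k) \<mapsto> (x, k + 1)\<close>.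
  The restriction is needed because actions in the library take values in \<open>extensional\<close>
  functions.
\<close>

definition dc_action ::
  "('w, 'b) monoid_scheme \<Rightarrow> 'w set \<Rightarrow> 'x set \<Rightarrow> ('w \<Rightarrow> 'x \<Rightarrow> 'x) \<Rightarrow>
   'w \<times> int \<Rightarrow> 'x \<times> bit \<Rightarrow> 'x \<times> bit" where
  "dc_action W S X \<phi> = (\<lambda>(w, a). \<lambda>(x, k) \<in> dc_carrier X.
     (\<phi> w x, k + of_nat (cox_length W S w) + of_int a))"

definition dc_ht :: "('x \<Rightarrow> int) \<Rightarrow> 'x \<times> bit \<Rightarrow> int" where
  "dc_ht ht = (\<lambda>(x, k). if of_int (ht x) = k then ht x else ht x + 1)"

end

theory Submission
  imports Defs
begin

text \<open>
  The cover height of \<open>(x, k)\<close> is the element of \<open>{ht x, ht x + 1}\<close> with the parity of \<open>k\<close>, and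
  every reflection of \<open>W \<times> A\<^sub>1\<close>, that is \<open>(r, 0)\<close> with \<open>r \<in> R(W)\<close> or \<open>(1, s\<^sub>0)\<close>, flips \<open>k\<close>.
  Hence heights of the cover always change by an odd amount, simple reflections change them by
  exactly one, and (QP1) holds vacuously upstairs.

  For (QP2) upstairs, the cover inequalities force either the strict inequalities of (QP2)
  downstairs or an equality of heights, to which (QP1) applies. Conversely, (QP1) downstairs is
  (QP2) upstairs for the simple reflection \<open>s\<^sub>0\<close> at the lift \<open>(x, ht x)\<close>, and (QP2) lifts at the
  same point because the inequalities and the scaling condition determine all four heights.
\<close>

section \<open>Words in Coxeter systems\<close>

lemma word_prod_Nil [simp]: "word_prod G [] = \<one>\<^bsub>G\<^esub>"
  by (simp add: word_prod_def)

lemma word_prod_Cons [simp]: "word_prod G (x # u) = x \<otimes>\<^bsub>G\<^esub> word_prod G u"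
  by (simp add: word_prod_def)

lemma (in monoid) word_prod_closed [simp]:
  "set u \<subseteq> carrier G \<Longrightarrow> word_prod G u \<in> carrier G"
  by (induction u) auto

lemma (in monoid) word_prod_append:
  "set u \<subseteq> carrier G \<Longrightarrow> set v \<subseteq> carrier G \<Longrightarrow>
    word_prod G (u @ v) = word_prod G u \<otimes> word_prod G v"
  by (induction u) (auto simp: m_assoc)

lemma word_prod_DirProd:
  "word_prod (G \<times>\<times> H) u = (word_prod G (map fst u), word_prod H (map snd u))"
  by (induction u) (auto simp: mult_DirProd')

lemma (in monoid) word_prod_replicate_one [simp]: "word_prod G (replicate n \<one>) = \<one>"
  by (induction n) auto

section \<open>Invariants and functoriality of the Coxeter congruence\<close>

lemma concat_replicate_pair_in_lists:
  "s \<in> S \<Longrightarrow> t \<in> S \<Longrightarrow> concat (replicate n [s, t]) \<in> lists S"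
  by (induction n) auto

lemma coxeter_cong_in_lists:
  "coxeter_cong S m u v \<Longrightarrow> u \<in> lists S \<and> v \<in> lists S"
proof (induction rule: coxeter_cong.induct)
  case (relation s t)
  then show ?case
    using concat_replicate_pair_in_lists[of s S t] by simp
qed auto

text \<open>Every relator repeats a pair of letters and so has even length. This invariant is the
  source of the sign character of a Coxeter group.\<close>

lemma coxeter_cong_even_length:
  "coxeter_cong S m u v \<Longrightarrow> even (length u) \<longleftrightarrow> even (length v)"
proof (induction rule: coxeter_cong.induct)
  case (relation s t)
  have "length (concat (replicate n [s, t])) = 2 * n" for n
    by (induction n) auto
  then show ?case by simp
qed auto

text \<open>The easy half of a presentation: once the relators evaluate to \<open>\<one>\<close>,
  evaluation respects the generated congruence.\<close>

lemma (in monoid) coxeter_cong_imp_word_prod_eq: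
  assumes "coxeter_cong S m u v" "S \<subseteq> carrier G"
    and rel: "\<And>s t. s \<in> S \<Longrightarrow> t \<in> S \<Longrightarrow> word_prod G (concat (replicate (m s t) [s, t])) = \<one>"
  shows "word_prod G u = word_prod G v"
  using assms(1)
proof (induction rule: coxeter_cong.induct)
  case (append u u' v v')
  then have "set u \<subseteq> carrier G" "set v \<subseteq> carrier G" "set u' \<subseteq> carrier G" "set v' \<subseteq> carrier G"
    using coxeter_cong_in_lists[of S m] assms(2) by (metis in_lists_conv_set subset_iff)+
  then show ?case
    using append.IH by (simp add: word_prod_append)
qed (auto simp: rel)

text \<open>A map of letters that preserves matrix entries sends relators to relators. It later
  transports congruences from the two factors into the product.\<close>

lemma coxeter_cong_map:
  assumes "coxeter_cong S m u v" "f ` S \<subseteq> T"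
    and "\<And>s t. s \<in> S \<Longrightarrow> t \<in> S \<Longrightarrow> m' (f s) (f t) = m s t"
  shows "coxeter_cong T m' (map f u) (map f v)"
  using assms(1)
proof (induction rule: coxeter_cong.induct)
  case (relation s t)
  then show ?case
    using coxeter_cong.relation[of "f s" T "f t" m'] assms(2,3)
    by (auto simp: map_concat)
next
  case (refl u)
  then have "map f u \<in> lists T"
    using assms(2) by (auto simp: image_subset_iff)
  then show ?case by (rule coxeter_cong.refl)
next
  case (append u u' v v')
  then show ?case by (simp add: coxeter_cong.append)
qed (blast intro: coxeter_cong.intros)+

context coxeter_system
begin

lemma word_prod_in_carrier: "u \<in> lists S \<Longrightarrow> word_prod W u \<in> carrier W"
  using simple_closed by (intro word_prod_closed) auto

lemma word_prod_eq_imp_even_length: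
  assumes "u \<in> lists S" "v \<in> lists S" "word_prod W u = word_prod W v"
  shows "even (length u) \<longleftrightarrow> even (length v)"
  using assms presentation coxeter_cong_even_length by metis

text \<open>Otherwise a one-letter word and the empty word would have the same product, against
  parity. This makes it possible to recognise the factor of a letter in a product.\<close>

lemma one_notin_simple: "\<one> \<notin> S"
  using word_prod_eq_imp_even_length[of "[\<one>]" "[]"] by auto

text \<open>The diagonal entries of the matrix are 1, so the relator of \<open>s\<close> with itself
  is the word \<open>ss\<close>.\<close>

lemma simple_mult_self:
  assumes "s \<in> S" shows "s \<otimes> s = \<one>"
proof -
  obtain m where m: "coxeter_matrix S m"
    and iff: "\<forall>u\<in>lists S. \<forall>v\<in>lists S.
      word_prod W u = word_prod W v \<longleftrightarrow> coxeter_cong S m u v"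
    using presentation by blast
  have "coxeter_cong S m [s, s] []"
    using coxeter_cong.relation[OF assms assms, of m] m assms by (simp add: coxeter_matrix_def)
  then show ?thesis
    using iff[rule_format, of "[s, s]" "[]"] assms simple_closed by auto
qed

lemma inv_simple: "s \<in> S \<Longrightarrow> inv s = s"
  using simple_mult_self simple_closed by (metis inv_equality subsetD)

lemma obtains_word:
  assumes "w \<in> carrier W"
  obtains u where "u \<in> lists S" "word_prod W u = w"
proof -
  have "w \<in> generate W S" using assms generated by simp
  then have "\<exists>u\<in>lists S. word_prod W u = w"
  proof (induction rule: generate.induct)
    case one
    show ?case by (rule bexI[of _ "[]"]) auto
  next
    case (incl s)
    then show ?case using simple_closed by (intro bexI[of _ "[s]"]) auto
  next
    \<comment> \<open>A simple reflection is an involution, so the letter itself represents its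
      inverse.\<close>
    case (inv s)
    then show ?case using simple_closed inv_simple by (intro bexI[of _ "[s]"]) auto
  next
    case (eng w w')
    then obtain u u' where "u \<in> lists S" "u' \<in> lists S" "word_prod W u = w" "word_prod W u' = w'"
      by blast
    then show ?case
      using word_prod_append[of u u'] simple_closed
      by (intro bexI[of _ "u @ u'"]) auto
  qed
  then show ?thesis using that by blast
qed

section \<open>Parity of the length function\<close>

lemma even_cox_length_word_prod:
  assumes "u \<in> lists S"
  shows "even (cox_length W S (word_prod W u)) \<longleftrightarrow> even (length u)"
proof -
  \<comment> \<open>The minimum is attained because \<open>u\<close> itself is a candidate. The
    minimal word \<open>v\<close> and \<open>u\<close> have the same product, hence lengths of the
    same parity.\<close>
  have "\<exists>v\<in>lists S. length v = cox_length W S (word_prod W u) \<and> word_prod W v = word_prod W u"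
    unfolding cox_length_def by (rule LeastI) (use assms in blast)
  then show ?thesis
    using word_prod_eq_imp_even_length[OF assms] by metis
qed

text \<open>Concatenating words multiplies their products and adds their lengths, so parity of
  length is a homomorphism to the group of order two.\<close>

lemma even_cox_length_mult:
  assumes "w \<in> carrier W" "w' \<in> carrier W"
  shows "even (cox_length W S (w \<otimes> w')) \<longleftrightarrow>
    (even (cox_length W S w) \<longleftrightarrow> even (cox_length W S w'))"
proof -
  obtain u where u: "u \<in> lists S" "word_prod W u = w" using assms obtains_word by metis
  obtain u' where u': "u' \<in> lists S" "word_prod W u' = w'" using assms obtains_word by metis
  have "word_prod W (u @ u') = w \<otimes> w'"
    using word_prod_append[of u u'] u u' simple_closed by auto
  then show ?thesis
    using even_cox_length_word_prod[of "u @ u'"] even_cox_length_word_prod[of u]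
      even_cox_length_word_prod[of u'] u u'
    by simp
qed

lemma even_cox_length_one: "even (cox_length W S \<one>)"
  using even_cox_length_word_prod[of "[]"] by simp

lemma odd_cox_length_simple: "s \<in> S \<Longrightarrow> odd (cox_length W S s)"
  using even_cox_length_word_prod[of "[s]"] simple_closed by auto

section \<open>Reflections\<close>

lemma reflections_subset_carrier: "reflections W S \<subseteq> carrier W"
  using simple_closed by (auto simp: reflections_def)

lemma simple_in_reflections: "s \<in> S \<Longrightarrow> s \<in> reflections W S"
  using simple_closed unfolding reflections_def
  by (intro CollectI exI[of _ \<one>] exI[of _ s]) auto

text \<open>As \<open>s\<close> is its own inverse, the right factor \<open>s\<close> completes a
  conjugation by \<open>s \<otimes> w\<close>.\<close>

lemma reflections_conj_simple:
  assumes "r \<in> reflections W S" "s \<in> S"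
  shows "s \<otimes> r \<otimes> s \<in> reflections W S"
proof -
  obtain w t where wt: "w \<in> carrier W" "t \<in> S" "r = w \<otimes> t \<otimes> inv w"
    using assms(1) by (auto simp: reflections_def)
  have "s \<otimes> r \<otimes> s = (s \<otimes> w) \<otimes> t \<otimes> inv (s \<otimes> w)"
    using wt assms(2) simple_closed inv_simple[of s] by (simp add: subset_iff inv_mult_group m_assoc)
  then show ?thesis
    using wt assms(2) simple_closed unfolding reflections_def by blast
qed

text \<open>The product of \<open>w\<close> and \<open>inv w\<close> has even length, so their
  parities agree and cancel, leaving the odd parity of the simple reflection
  \<open>t\<close>.\<close>

lemma odd_cox_length_reflection:
  assumes "r \<in> reflections W S"
  shows "odd (cox_length W S r)"
proof -
  obtain w t where wt: "w \<in> carrier W" "t \<in> S" "r = w \<otimes> t \<otimes> inv w"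
    using assms by (auto simp: reflections_def)
  have "even (cox_length W S w) \<longleftrightarrow> even (cox_length W S (inv w))"
    using even_cox_length_mult[of w "inv w"] wt even_cox_length_one by simp
  then show ?thesis
    using wt simple_closed odd_cox_length_simple[of t]
    by (auto simp: even_cox_length_mult subset_iff)
qed

end

section \<open>Products of Coxeter systems\<close>

lemma simple_prod_cases:
  assumes "p \<in> simple_prod W S W' S'"
  obtains s where "s \<in> S" "p = (s, \<one>\<^bsub>W'\<^esub>)" | s' where "s' \<in> S'" "p = (\<one>\<^bsub>W\<^esub>, s')"
  using assms by (auto simp: simple_prod_def)

locale coxeter_system_pair = L: coxeter_system W S + R: coxeter_system W' S'
  for W :: "('w, 'b) monoid_scheme" (structure) and S
    and W' :: "('v, 'c) monoid_scheme" (structure) and S'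
begin

section \<open>Splitting words over the simple reflections of a product\<close>

abbreviation T where "T \<equiv> simple_prod W S W' S'"
abbreviation inl where "inl \<equiv> \<lambda>s. (s, \<one>\<^bsub>W'\<^esub>)"
abbreviation inr where "inr \<equiv> \<lambda>s'. (\<one>\<^bsub>W\<^esub>, s')"

text \<open>A letter of \<open>T\<close> comes from \<open>S\<close> exactly if its second component
  is one, because \<open>S'\<close> does not contain the identity. The same test serves
  \<open>rpart\<close>.\<close>

definition lpart :: "('w \<times> 'v) list \<Rightarrow> 'w list" where
  "lpart u = map fst (filter (\<lambda>p. snd p = \<one>\<^bsub>W'\<^esub>) u)"

definition rpart :: "('w \<times> 'v) list \<Rightarrow> 'v list" where
  "rpart u = map snd (filter (\<lambda>p. snd p \<noteq> \<one>\<^bsub>W'\<^esub>) u)"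

lemma simple_prod_subset: "T \<subseteq> carrier (W \<times>\<times> W')"
  using L.simple_closed R.simple_closed by (auto simp: simple_prod_def)

lemma inl_in [simp]: "s \<in> S \<Longrightarrow> inl s \<in> T"
  by (simp add: simple_prod_def)

lemma inr_in [simp]: "s' \<in> S' \<Longrightarrow> inr s' \<in> T"
  by (simp add: simple_prod_def)

lemma snd_ne: "s' \<in> S' \<Longrightarrow> s' \<noteq> \<one>\<^bsub>W'\<^esub>"
  using R.one_notin_simple by blast

lemma lpart_in:
  assumes "u \<in> lists T" shows "lpart u \<in> lists S"
proof -
  have "fst p \<in> S" if "p \<in> T" "snd p = \<one>\<^bsub>W'\<^esub>" for p
    using that(1) by (cases rule: simple_prod_cases) (use that(2) snd_ne in auto)
  moreover have "\<forall>p\<in>set u. p \<in> T" using assms by blast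
  ultimately show ?thesis unfolding lpart_def by (auto simp: in_lists_conv_set)
qed

lemma rpart_in:
  assumes "u \<in> lists T" shows "rpart u \<in> lists S'"
proof -
  have "snd p \<in> S'" if "p \<in> T" "snd p \<noteq> \<one>\<^bsub>W'\<^esub>" for p
    using that(1) by (cases rule: simple_prod_cases) (use that(2) in auto)
  moreover have "\<forall>p\<in>set u. p \<in> T" using assms by blast
  ultimately show ?thesis unfolding rpart_def by (auto simp: in_lists_conv_set)
qed

text \<open>A letter of one factor has the identity in the other coordinate, so only the order of
  letters within each factor affects the product.\<close>

lemma word_prod_parts:
  "u \<in> lists T \<Longrightarrow> word_prod (W \<times>\<times> W') u = (word_prod W (lpart u), word_prod W' (rpart u))"
proof (induction u)
  case Nil
  then show ?case by (simp add: lpart_def rpart_def)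
next
  case (Cons p u)
  have closed: "word_prod W (lpart u) \<in> carrier W" "word_prod W' (rpart u) \<in> carrier W'"
    using Cons.prems lpart_in[of u] rpart_in[of u] L.word_prod_in_carrier R.word_prod_in_carrier
    by auto
  have IH: "word_prod (W \<times>\<times> W') u = (word_prod W (lpart u), word_prod W' (rpart u))"
    using Cons by simp
  have "p \<in> T" using Cons.prems by simp
  then show ?case
  proof (cases rule: simple_prod_cases)
    case (1 s)
    then show ?thesis using IH closed by (simp add: lpart_def rpart_def)
  next
    case (2 s)
    then show ?thesis using IH closed snd_ne[of s] by (simp add: lpart_def rpart_def)
  qed
qed

lemma word_prod_map_inl:
  "u \<in> lists S \<Longrightarrow> word_prod (W \<times>\<times> W') (map inl u) = (word_prod W u, \<one>\<^bsub>W'\<^esub>)"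
  by (simp add: word_prod_DirProd o_def map_replicate_const)

lemma word_prod_map_inr:
  "u \<in> lists S' \<Longrightarrow> word_prod (W \<times>\<times> W') (map inr u) = (\<one>\<^bsub>W\<^esub>, word_prod W' u)"
  by (simp add: word_prod_DirProd o_def map_replicate_const)

lemma map_inl_inr_in:
  "u \<in> lists S \<Longrightarrow> u' \<in> lists S' \<Longrightarrow> map inl u @ map inr u' \<in> lists T"
  by (auto simp: simple_prod_def)

lemma word_prod_map_inl_inr:
  assumes u: "u \<in> lists S" and u': "u' \<in> lists S'"
  shows "word_prod (W \<times>\<times> W') (map inl u @ map inr u') = (word_prod W u, word_prod W' u')"
proof -
  interpret P: group "W \<times>\<times> W'" by (rule DirProd_group) unfold_locales
  have "set (map inl u) \<subseteq> carrier (W \<times>\<times> W')" "set (map inr u') \<subseteq> carrier (W \<times>\<times> W')"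
    using u u' L.simple_closed R.simple_closed by auto
  then have "word_prod (W \<times>\<times> W') (map inl u @ map inr u') =
      (word_prod W u, \<one>\<^bsub>W'\<^esub>) \<otimes>\<^bsub>W \<times>\<times> W'\<^esub> (\<one>\<^bsub>W\<^esub>, word_prod W' u')"
    by (simp only: P.word_prod_append word_prod_map_inl[OF u] word_prod_map_inr[OF u'])
  then show ?thesis
    using L.word_prod_in_carrier[OF u] R.word_prod_in_carrier[OF u'] by simp
qed

section \<open>The product is a Coxeter system\<close>

lemma generate_simple_prod: "generate (W \<times>\<times> W') T = carrier (W \<times>\<times> W')"
proof
  interpret P: group "W \<times>\<times> W'" by (rule DirProd_group) unfold_locales
  show "generate (W \<times>\<times> W') T \<subseteq> carrier (W \<times>\<times> W')"
    using P.generate_incl simple_prod_subset by blast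
  have gen: "word_prod (W \<times>\<times> W') u \<in> generate (W \<times>\<times> W') T" if "u \<in> lists T" for u
    using that
    by (induction u) (simp_all add: generate.one generate.incl generate.eng del: one_DirProd)
  show "carrier (W \<times>\<times> W') \<subseteq> generate (W \<times>\<times> W') T"
  proof
    fix p assume "p \<in> carrier (W \<times>\<times> W')"
    then obtain w w' where p: "p = (w, w')" "w \<in> carrier W" "w' \<in> carrier W'"
      by auto
    obtain u where u: "u \<in> lists S" "word_prod W u = w" by (rule L.obtains_word[OF p(2)])
    obtain u' where u': "u' \<in> lists S'" "word_prod W' u' = w'" by (rule R.obtains_word[OF p(3)])
    show "p \<in> generate (W \<times>\<times> W') T"
      using gen[OF map_inl_inr_in[OF u(1) u'(1)]]
      by (simp only: word_prod_map_inl_inr[OF u(1) u'(1)] u(2) u'(2) p(1))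
  qed
qed

text \<open>The relators hold in the product, which gives one direction. Conversely, equal products
  have equal coordinates, so the parts are congruent in the factors; \<open>coxeter_cong_map\<close>
  and the normal form bring this back to the original words.\<close>

lemma coxeter_presentation_DirProd:
  "\<exists>m. coxeter_matrix T m \<and> (\<forall>u\<in>lists T. \<forall>v\<in>lists T.
     word_prod (W \<times>\<times> W') u = word_prod (W \<times>\<times> W') v \<longleftrightarrow> coxeter_cong T m u v)"
proof -
  interpret P: group "W \<times>\<times> W'" by (rule DirProd_group) unfold_locales
  obtain mL where mL: "coxeter_matrix S mL"
    and L: "\<forall>u\<in>lists S. \<forall>v\<in>lists S.
      word_prod W u = word_prod W v \<longleftrightarrow> coxeter_cong S mL u v"
    using L.presentation by blast
  obtain mR where mR: "coxeter_matrix S' mR"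
    and R: "\<forall>u\<in>lists S'. \<forall>v\<in>lists S'.
      word_prod W' u = word_prod W' v \<longleftrightarrow> coxeter_cong S' mR u v"
    using R.presentation by blast
  \<comment> \<open>The given matrices are the diagonal blocks. Entry 2 for mixed pairs expresses
    that the factors commute.\<close>
  define m where "m p q =
    (if snd p = \<one>\<^bsub>W'\<^esub> \<and> snd q = \<one>\<^bsub>W'\<^esub> then mL (fst p) (fst q)
     else if snd p \<noteq> \<one>\<^bsub>W'\<^esub> \<and> snd q \<noteq> \<one>\<^bsub>W'\<^esub> then mR (snd p) (snd q) else 2)" for p q
  have m_inl [simp]: "m (inl s) (inl t) = mL s t" if "s \<in> S" "t \<in> S" for s t
    by (simp add: m_def)
  have m_inr [simp]: "m (inr s) (inr t) = mR s t" if "s \<in> S'" "t \<in> S'" for s t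
    using that snd_ne by (simp add: m_def)
  have m_mixed [simp]: "m (inl s) (inr t) = 2" "m (inr t) (inl s) = 2" if "s \<in> S" "t \<in> S'" for s t
    using that snd_ne by (simp_all add: m_def)
  have matrix: "coxeter_matrix T m"
    unfolding coxeter_matrix_def
  proof (intro conjI ballI impI)
    fix p assume "p \<in> T"
    then show "m p p = 1"
      using mL mR by (auto elim!: simple_prod_cases simp: coxeter_matrix_def)
  next
    fix p q assume "p \<in> T" "q \<in> T" "p \<noteq> q"
    then have "m p q = m q p \<and> m p q \<noteq> 1"
      using mL mR by (auto elim!: simple_prod_cases simp: coxeter_matrix_def) metis+
    then show "m p q = m q p" "m p q \<noteq> 1" by auto
  qed
  have relL: "coxeter_cong S mL (concat (replicate (mL s t) [s, t])) []" if "s \<in> S" "t \<in> S" for s t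
    using that by (rule coxeter_cong.relation)
  have relR: "coxeter_cong S' mR (concat (replicate (mR s t) [s, t])) []" if "s \<in> S'" "t \<in> S'" for s t
    using that by (rule coxeter_cong.relation)
  have rel: "word_prod (W \<times>\<times> W') (concat (replicate (m p q) [p, q])) = \<one>\<^bsub>W \<times>\<times> W'\<^esub>"
    if pq: "p \<in> T" "q \<in> T" for p q
  proof -
    consider (LL) s t where "s \<in> S" "t \<in> S" "p = inl s" "q = inl t"
      | (RR) s t where "s \<in> S'" "t \<in> S'" "p = inr s" "q = inr t"
      | (LR) s t where "s \<in> S" "t \<in> S'" "p = inl s" "q = inr t"
      | (RL) s t where "s \<in> S'" "t \<in> S" "p = inr s" "q = inl t"
      using pq by (elim simple_prod_cases) auto
    then show ?thesis
    proof cases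
      case LL
      let ?c = "concat (replicate (mL s t) [s, t])"
      have "word_prod W ?c = word_prod W []"
        using L[rule_format, of ?c "[]"] relL[OF LL(1,2)]
          concat_replicate_pair_in_lists[OF LL(1,2)] by simp
      moreover have "concat (replicate (m p q) [p, q]) = map inl ?c"
        using LL by (simp add: map_concat)
      ultimately show ?thesis
        using word_prod_map_inl[OF concat_replicate_pair_in_lists[OF LL(1,2)]] by simp
    next
      case RR
      let ?c = "concat (replicate (mR s t) [s, t])"
      have "word_prod W' ?c = word_prod W' []"
        using R[rule_format, of ?c "[]"] relR[OF RR(1,2)]
          concat_replicate_pair_in_lists[OF RR(1,2)] by simp
      moreover have "concat (replicate (m p q) [p, q]) = map inr ?c"
        using RR by (simp add: map_concat)
      ultimately show ?thesis
        using word_prod_map_inr[OF concat_replicate_pair_in_lists[OF RR(1,2)]] by simp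
    next
      \<comment> \<open>The relator \<open>p q p q\<close> evaluates to the pair of squares of
        \<open>s\<close> and \<open>t\<close>, and both are involutions.\<close>
      case LR
      then have "s \<in> carrier W" "t \<in> carrier W'"
        using L.simple_closed R.simple_closed by auto
      then show ?thesis
        using LR L.simple_mult_self[of s] R.simple_mult_self[of t] by (simp add: numeral_2_eq_2)
    next
      case RL
      then have "t \<in> carrier W" "s \<in> carrier W'"
        using L.simple_closed R.simple_closed by auto
      then show ?thesis
        using RL L.simple_mult_self[of t] R.simple_mult_self[of s] by (simp add: numeral_2_eq_2)
    qed
  qed
  have cancel: "coxeter_cong T m [p, p] []" if "p \<in> T" for p
    using coxeter_cong.relation[OF that that, of m] matrix that by (simp add: coxeter_matrix_def)
  have swap: "coxeter_cong T m [inr t, inl s] [inl s, inr t]" if st: "s \<in> S" "t \<in> S'" for s t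
  proof -
    let ?a = "inl s" and ?b = "inr t"
    note app = coxeter_cong.append
    have T: "?a \<in> T" "?b \<in> T" using st by auto
    have rel: "coxeter_cong T m [?a, ?b, ?a, ?b] []"
      using coxeter_cong.relation[OF T, of m] st by (simp add: numeral_2_eq_2)
    have r: "coxeter_cong T m [?b, ?a] [?b, ?a]" "coxeter_cong T m [?a] [?a]"
      "coxeter_cong T m [?a, ?b] [?a, ?b]"
      "coxeter_cong T m [?a, ?b, ?a] [?a, ?b, ?a]"
      using T by (auto intro!: coxeter_cong.refl)
    \<comment> \<open>The word \<open>ababba\<close> is reduced in two ways: deleting the relator
      \<open>abab\<close> leaves \<open>ba\<close>, while deleting \<open>bb\<close> and then
      \<open>aa\<close> leaves \<open>ab\<close>.\<close>
    have "coxeter_cong T m [?a, ?b, ?a, ?b, ?b, ?a] [?b, ?a]"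
      using app[OF rel r(1)] by simp
    moreover have "coxeter_cong T m [?a, ?b, ?a, ?b, ?b, ?a] [?a, ?b, ?a, ?a]"
      using app[OF app[OF r(4) cancel[OF T(2)]] r(2)] by simp
    moreover have "coxeter_cong T m [?a, ?b, ?a, ?a] [?a, ?b]"
      using app[OF r(3) cancel[OF T(1)]] by simp
    ultimately show ?thesis
      by (blast intro: coxeter_cong.sym coxeter_cong.trans)
  qed
  have move: "coxeter_cong T m (inr t # map inl u) (map inl u @ [inr t])"
    if "t \<in> S'" "u \<in> lists S" for t u
    using that(2)
  proof (induction u)
    case Nil
    then show ?case using that by (auto intro!: coxeter_cong.refl)
  next
    case (Cons s u)
    have 1: "coxeter_cong T m ([inr t, inl s] @ map inl u) ([inl s, inr t] @ map inl u)"
      using Cons swap[of s t] that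
      by (intro coxeter_cong.append) (auto intro!: coxeter_cong.refl)
    have 2: "coxeter_cong T m ([inl s] @ (inr t # map inl u)) ([inl s] @ (map inl u @ [inr t]))"
      using Cons by (intro coxeter_cong.append) (auto intro!: coxeter_cong.refl)
    show ?case
      using coxeter_cong.trans[OF 1] 2 by simp
  qed
  \<comment> \<open>The commutation relations separate the two kinds of letters, which reduces the word problem
    of the product to those of the factors.\<close>
  have normal: "coxeter_cong T m u (map inl (lpart u) @ map inr (rpart u))" if "u \<in> lists T" for u
    using that
  proof (induction u)
    case Nil
    then show ?case by (auto simp: lpart_def rpart_def intro!: coxeter_cong.refl)
  next
    case (Cons p u)
    then have IH: "coxeter_cong T m u (map inl (lpart u) @ map inr (rpart u))"
      and p: "p \<in> T" and u: "u \<in> lists T" by auto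
    have step: "coxeter_cong T m ([p] @ u) ([p] @ (map inl (lpart u) @ map inr (rpart u)))"
      using IH p by (intro coxeter_cong.append) (auto intro!: coxeter_cong.refl)
    show ?case
      using p
    proof (cases rule: simple_prod_cases)
      case (1 s)
      then show ?thesis using step by (simp add: lpart_def rpart_def)
    next
      case (2 t)
      have "coxeter_cong T m ((inr t # map inl (lpart u)) @ map inr (rpart u))
        ((map inl (lpart u) @ [inr t]) @ map inr (rpart u))"
        using move[OF 2(1) lpart_in[OF u]] rpart_in[OF u]
        by (intro coxeter_cong.append) (auto intro!: coxeter_cong.refl)
      then show ?thesis
        using coxeter_cong.trans[OF step] 2 snd_ne by (simp add: lpart_def rpart_def)
    qed
  qed
  have "word_prod (W \<times>\<times> W') u = word_prod (W \<times>\<times> W') v \<longleftrightarrow> coxeter_cong T m u v"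
    if u: "u \<in> lists T" and v: "v \<in> lists T" for u v
  proof
    assume "coxeter_cong T m u v"
    then show "word_prod (W \<times>\<times> W') u = word_prod (W \<times>\<times> W') v"
      using simple_prod_subset rel by (rule P.coxeter_cong_imp_word_prod_eq)
  next
    assume "word_prod (W \<times>\<times> W') u = word_prod (W \<times>\<times> W') v"
    then have "coxeter_cong S mL (lpart u) (lpart v)" "coxeter_cong S' mR (rpart u) (rpart v)"
      using L[rule_format, OF lpart_in[OF u] lpart_in[OF v]]
        R[rule_format, OF rpart_in[OF u] rpart_in[OF v]]
        word_prod_parts[OF u] word_prod_parts[OF v] by auto
    then have "coxeter_cong T m (map inl (lpart u)) (map inl (lpart v))"
      "coxeter_cong T m (map inr (rpart u)) (map inr (rpart v))"
      by (auto intro!: coxeter_cong_map)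
    then have "coxeter_cong T m (map inl (lpart u) @ map inr (rpart u))
      (map inl (lpart v) @ map inr (rpart v))"
      by (rule coxeter_cong.append)
    then show "coxeter_cong T m u v"
      using normal[OF u] normal[OF v] by (blast intro: coxeter_cong.sym coxeter_cong.trans)
  qed
  with matrix show ?thesis by blast
qed

lemma coxeter_system_DirProd: "coxeter_system (W \<times>\<times> W') T"
proof -
  interpret P: group "W \<times>\<times> W'" by (rule DirProd_group) unfold_locales
  have "finite T"
    using L.finite_rank R.finite_rank by (simp add: simple_prod_def)
  then show ?thesis
    by (intro coxeter_system.intro coxeter_system_axioms.intro P.group_axioms simple_prod_subset
        generate_simple_prod coxeter_presentation_DirProd)
qed

text \<open>The pair is the product of a word for \<open>w\<close> followed by a word for
  \<open>w'\<close>, and the lengths of the two words add.\<close>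

lemma even_cox_length_DirProd:
  assumes "w \<in> carrier W" "w' \<in> carrier W'"
  shows "even (cox_length (W \<times>\<times> W') T (w, w')) \<longleftrightarrow>
    (even (cox_length W S w) \<longleftrightarrow> even (cox_length W' S' w'))"
proof -
  interpret P: coxeter_system "W \<times>\<times> W'" T by (rule coxeter_system_DirProd)
  obtain u where u: "u \<in> lists S" "word_prod W u = w" by (rule L.obtains_word[OF assms(1)])
  obtain u' where u': "u' \<in> lists S'" "word_prod W' u' = w'" by (rule R.obtains_word[OF assms(2)])
  show ?thesis
    using P.even_cox_length_word_prod[OF map_inl_inr_in[OF u(1) u'(1)]]
      L.even_cox_length_word_prod[OF u(1)] R.even_cox_length_word_prod[OF u'(1)]
    by (simp only: word_prod_map_inl_inr[OF u(1) u'(1)] u(2) u'(2) length_append length_map even_add)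
qed

text \<open>Conjugating a letter of one factor by \<open>(w, w')\<close> leaves the identity in the
  other coordinate. Conversely, a conjugation in one factor lifts to a conjugation by
  \<open>inl w\<close> or \<open>inr w\<close>.\<close>

lemma reflections_DirProd:
  "reflections (W \<times>\<times> W') T = inl ` reflections W S \<union> inr ` reflections W' S'"
proof -
  have conj_inl: "(w, w') \<otimes>\<^bsub>W \<times>\<times> W'\<^esub> inl s \<otimes>\<^bsub>W \<times>\<times> W'\<^esub> inv\<^bsub>W \<times>\<times> W'\<^esub> (w, w')
      = inl (w \<otimes>\<^bsub>W\<^esub> s \<otimes>\<^bsub>W\<^esub> inv\<^bsub>W\<^esub> w)"
    if "w \<in> carrier W" "w' \<in> carrier W'" for w w' s
    using that by (simp add: inv_DirProd[OF L.group_axioms R.group_axioms])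
  have conj_inr: "(w, w') \<otimes>\<^bsub>W \<times>\<times> W'\<^esub> inr s' \<otimes>\<^bsub>W \<times>\<times> W'\<^esub> inv\<^bsub>W \<times>\<times> W'\<^esub> (w, w')
      = inr (w' \<otimes>\<^bsub>W'\<^esub> s' \<otimes>\<^bsub>W'\<^esub> inv\<^bsub>W'\<^esub> w')"
    if "w \<in> carrier W" "w' \<in> carrier W'" for w w' s'
    using that by (simp add: inv_DirProd[OF L.group_axioms R.group_axioms])
  show ?thesis
  proof (intro equalityI Un_least subsetI)
    fix p assume "p \<in> reflections (W \<times>\<times> W') T"
    then obtain g t where g: "g \<in> carrier (W \<times>\<times> W')" and t: "t \<in> T"
      and p: "p = g \<otimes>\<^bsub>W \<times>\<times> W'\<^esub> t \<otimes>\<^bsub>W \<times>\<times> W'\<^esub> inv\<^bsub>W \<times>\<times> W'\<^esub> g"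
      unfolding reflections_def by blast
    obtain w w' where g: "g = (w, w')" "w \<in> carrier W" "w' \<in> carrier W'"
      using g by (cases g) simp
    from t show "p \<in> inl ` reflections W S \<union> inr ` reflections W' S'"
    proof (cases rule: simple_prod_cases)
      case (1 s)
      then have "p = inl (w \<otimes>\<^bsub>W\<^esub> s \<otimes>\<^bsub>W\<^esub> inv\<^bsub>W\<^esub> w)"
        using p g conj_inl by (simp only:)
      then show ?thesis using 1 g unfolding reflections_def by blast
    next
      case (2 s)
      then have "p = inr (w' \<otimes>\<^bsub>W'\<^esub> s \<otimes>\<^bsub>W'\<^esub> inv\<^bsub>W'\<^esub> w')"
        using p g conj_inr by (simp only:)
      then show ?thesis using 2 g unfolding reflections_def by blast
    qed
  next
    fix p assume "p \<in> inl ` reflections W S"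
    then obtain w s where *: "w \<in> carrier W" "s \<in> S" "p = inl (w \<otimes>\<^bsub>W\<^esub> s \<otimes>\<^bsub>W\<^esub> inv\<^bsub>W\<^esub> w)"
      unfolding reflections_def by blast
    then show "p \<in> reflections (W \<times>\<times> W') T"
      unfolding reflections_def *(3) conj_inl[OF *(1) R.one_closed, symmetric]
      by (intro CollectI exI[of _ "inl w"] exI[of _ "inl s"]) simp
  next
    fix p assume "p \<in> inr ` reflections W' S'"
    then obtain w s where *: "w \<in> carrier W'" "s \<in> S'" "p = inr (w \<otimes>\<^bsub>W'\<^esub> s \<otimes>\<^bsub>W'\<^esub> inv\<^bsub>W'\<^esub> w)"
      unfolding reflections_def by blast
    then show "p \<in> reflections (W \<times>\<times> W') T"
      unfolding reflections_def *(3) conj_inr[OF L.one_closed *(1), symmetric]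
      by (intro CollectI exI[of _ "inr w"] exI[of _ "inr s"]) simp
  qed
qed

end

section \<open>The Coxeter group of order two\<close>

lemma carrier_A1: "carrier A1 = {0, 1}"
  by (auto simp: carrier_integer_mod_group)

lemma word_prod_A1: "u \<in> lists {s0} \<Longrightarrow> word_prod A1 u = int (length u) mod 2"
  by (induction u) (auto simp: mod_simps add.commute)

text \<open>The single relator is the square of \<open>s0\<close>. Parity of the word length decides
  both equality of products and congruence of words.\<close>

lemma coxeter_system_A1: "coxeter_system A1 {s0}"
proof -
  interpret group A1 by simp
  have "1 \<in> generate A1 {s0}" "\<one>\<^bsub>A1\<^esub> \<in> generate A1 {s0}"
    by (simp add: generate.incl) (rule generate.one)
  then have gen: "generate A1 {s0} = carrier A1"
    using generate_incl[of "{s0}"] by (auto simp: carrier_A1)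
  define m :: "int \<Rightarrow> int \<Rightarrow> nat" where "m = (\<lambda>_ _. 1)"
  have relation: "coxeter_cong {s0} m [s0, s0] []"
    using coxeter_cong.relation[of s0 "{s0}" s0 m] by (simp add: m_def)
  \<comment> \<open>Deleting two letters at a time leaves a word with at most one letter.\<close>
  have normal: "coxeter_cong {s0} m (replicate n s0) (replicate (n mod 2) s0)" for n
  proof (induction n rule: less_induct)
    case (less n)
    show ?case
    proof (cases "n < 2")
      case True
      then show ?thesis by (auto intro: coxeter_cong.refl)
    next
      case False
      then obtain k where n: "n = k + 2" by (metis add.commute le_Suc_ex not_less)
      have "coxeter_cong {s0} m ([s0, s0] @ replicate k s0) ([] @ replicate (k mod 2) s0)"
        using relation less[of k] n by (intro coxeter_cong.append) auto
      moreover have "replicate n s0 = [s0, s0] @ replicate k s0" "n mod 2 = k mod 2"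
        by (simp_all add: n)
      ultimately show ?thesis by (simp only: append_Nil)
    qed
  qed
  have rep: "u = replicate (length u) s0" if "u \<in> lists {s0}" for u
    using that by (induction u) auto
  have "word_prod A1 u = word_prod A1 v \<longleftrightarrow> coxeter_cong {s0} m u v"
    if uv: "u \<in> lists {s0}" "v \<in> lists {s0}" for u v
  proof -
    have "word_prod A1 u = word_prod A1 v \<longleftrightarrow> (even (length u) \<longleftrightarrow> even (length v))"
      using uv by (simp add: word_prod_A1) presburger
    also have "\<dots> \<longleftrightarrow> coxeter_cong {s0} m u v"
    proof
      assume "even (length u) \<longleftrightarrow> even (length v)"
      then have "length u mod 2 = length v mod 2" by presburger
      then show "coxeter_cong {s0} m u v"
        using normal[of "length u"] normal[of "length v"] rep[OF uv(1)] rep[OF uv(2)]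
        by (metis coxeter_cong.sym coxeter_cong.trans)
    qed (rule coxeter_cong_even_length)
    finally show ?thesis .
  qed
  moreover have "coxeter_matrix {s0} m"
    by (simp add: coxeter_matrix_def m_def)
  ultimately show ?thesis
    by unfold_locales (use gen in \<open>auto simp: carrier_A1\<close>)
qed

text \<open>The group is abelian, so conjugation fixes \<open>s0\<close>.\<close>

lemma reflections_A1: "reflections A1 {s0} = {s0}"
proof -
  have "w \<otimes>\<^bsub>A1\<^esub> s0 \<otimes>\<^bsub>A1\<^esub> inv\<^bsub>A1\<^esub> w = s0" if "w \<in> carrier A1" for w
    using that by (auto simp: carrier_A1)
  then have "reflections A1 {s0} \<subseteq> {s0}"
    unfolding reflections_def by blast
  then show ?thesis
    using coxeter_system.simple_in_reflections[OF coxeter_system_A1, of s0] by blast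
qed


section \<open>The even double cover\<close>

text \<open>The map of the inverse element witnesses bijectivity. Extensionality turns the pointwise
  multiplication law into an equation in \<open>BijGroup E\<close>.\<close>

lemma group_actionI:
  assumes "group G"
    and "\<And>g. g \<in> carrier G \<Longrightarrow> \<phi> g \<in> extensional E"
    and closed: "\<And>g x. g \<in> carrier G \<Longrightarrow> x \<in> E \<Longrightarrow> \<phi> g x \<in> E"
    and one: "\<And>x. x \<in> E \<Longrightarrow> \<phi> \<one>\<^bsub>G\<^esub> x = x"
    and mult: "\<And>g h x. g \<in> carrier G \<Longrightarrow> h \<in> carrier G \<Longrightarrow> x \<in> E \<Longrightarrow>
      \<phi> (g \<otimes>\<^bsub>G\<^esub> h) x = \<phi> g (\<phi> h x)"
  shows "group_action G E \<phi>"
proof -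
  interpret group G by fact
  have Bij: "\<phi> g \<in> Bij E" if g: "g \<in> carrier G" for g
  proof -
    have "bij_betw (\<phi> g) E E"
      using g closed mult[of "inv\<^bsub>G\<^esub> g" g] mult[of g "inv\<^bsub>G\<^esub> g"] one
      by (intro bij_betw_byWitness[where f' = "\<phi> (inv\<^bsub>G\<^esub> g)"]) auto
    then show ?thesis using assms(2)[OF g] by (simp add: Bij_def)
  qed
  have "\<phi> (g \<otimes>\<^bsub>G\<^esub> h) = compose E (\<phi> g) (\<phi> h)" if "g \<in> carrier G" "h \<in> carrier G" for g h
    using that mult assms(2)[of "g \<otimes>\<^bsub>G\<^esub> h"]
    by (intro extensionalityI[of _ E]) (auto simp: compose_def)
  then have "\<phi> \<in> hom G (BijGroup E)"
    using Bij by (auto simp: hom_def BijGroup_def)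
  then show ?thesis
    by (intro group_action.intro group_hom.intro group_hom_axioms.intro group_BijGroup assms(1))
qed

text \<open>Together with the three facts that follow, this turns identities between bits into
  propositional equivalences between parities.\<close>

lemma bit_eq_iff_zero: "a = b \<longleftrightarrow> (a = 0 \<longleftrightarrow> b = 0)" for a b :: bit
  by (cases a; cases b) auto

lemma bit_add_eq_0_iff: "a + b = 0 \<longleftrightarrow> (a = 0 \<longleftrightarrow> b = 0)" for a b :: bit
  by (cases a; cases b) auto

lemma of_nat_bit_eq_0_iff: "(of_nat n :: bit) = 0 \<longleftrightarrow> even n"
  by (induction n) (auto simp: bit_add_eq_0_iff simp del: add_bit_eq_xor)

lemma of_int_bit_eq_0_iff: "(of_int n :: bit) = 0 \<longleftrightarrow> even n"
proof (cases n)
  case (nonneg k)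
  then show ?thesis by (simp add: of_nat_bit_eq_0_iff)
next
  case (neg k)
  then show ?thesis
    using of_nat_bit_eq_0_iff[of "Suc k"] by (simp del: of_nat_Suc)
qed

lemma dc_ht_eq: "dc_ht ht (x, k) = (if even (ht x) \<longleftrightarrow> k = 0 then ht x else ht x + 1)"
proof -
  have "of_int (ht x) = k \<longleftrightarrow> (even (ht x) \<longleftrightarrow> k = 0)"
    by (subst bit_eq_iff_zero) (simp only: of_int_bit_eq_0_iff)
  then show ?thesis by (simp add: dc_ht_def)
qed

text \<open>Reflections of the product flip the bit. Expressing the new height through the old
  \<open>k\<close> allows both heights to be compared by cases on one truth value.\<close>

lemma dc_ht_add_1: "dc_ht ht (x, k + 1) = (if even (ht x) \<longleftrightarrow> k \<noteq> 0 then ht x else ht x + 1)"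
  unfolding dc_ht_eq bit_add_eq_0_iff by simp

section \<open>Action, scaling and stabilizers on the cover\<close>

context scaled_set
begin

interpretation A: coxeter_system A1 "{s0}" by (rule coxeter_system_A1)
interpretation P: coxeter_system_pair W S A1 "{s0}" by unfold_locales
interpretation D: coxeter_system "W \<times>\<times> A1" "simple_prod W S A1 {s0}"
  by (rule P.coxeter_system_DirProd)

abbreviation "dS \<equiv> simple_prod W S A1 {s0}"
abbreviation "dX \<equiv> dc_carrier X"
abbreviation "d\<phi> \<equiv> dc_action W S X \<phi>"
abbreviation "dht \<equiv> dc_ht ht"

lemma dc_action_eq:
  "x \<in> X \<Longrightarrow> d\<phi> (w, a) (x, k) = (\<phi> w x, k + of_nat (cox_length W S w) + of_int a)"
  by (simp add: dc_action_def dc_carrier_def)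

lemma one_action: "x \<in> X \<Longrightarrow> \<phi> \<one> x = x"
  using fun_cong[OF id_eq_one, of x] by simp

text \<open>On the second coordinate \<open>(w, a)\<close> translates by the sum of the parities of
  the length of \<open>w\<close> and of \<open>a\<close>, which is a homomorphism to the field with
  two elements.\<close>

lemma dc_group_action: "group_action (W \<times>\<times> A1) dX d\<phi>"
proof (rule group_actionI)
  show "group (W \<times>\<times> A1)" by (rule D.group_axioms)
next
  fix g assume "g \<in> carrier (W \<times>\<times> A1)"
  then show "d\<phi> g \<in> extensional dX"
    by (auto simp: dc_action_def)
next
  fix g p assume "g \<in> carrier (W \<times>\<times> A1)" "p \<in> dX"
  then show "d\<phi> g p \<in> dX"
    using element_image by (auto simp: dc_carrier_def dc_action_eq)
next
  fix p assume "p \<in> dX"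
  then obtain x k where p: "p = (x, k)" "x \<in> X" by (auto simp: dc_carrier_def)
  have "(of_nat (cox_length W S \<one>) :: bit) = 0"
    using even_cox_length_one by (simp add: of_nat_bit_eq_0_iff)
  then show "d\<phi> \<one>\<^bsub>W \<times>\<times> A1\<^esub> p = p"
    using p one_action by (simp add: dc_action_eq del: add_bit_eq_xor)
next
  fix g h p assume "g \<in> carrier (W \<times>\<times> A1)" "h \<in> carrier (W \<times>\<times> A1)" "p \<in> dX"
  then obtain w a v b x k where *: "g = (w, a)" "h = (v, b)" "p = (x, k)" "w \<in> carrier W"
    "v \<in> carrier W" "x \<in> X"
    by (auto simp: dc_carrier_def)
  have "even ((a + b) mod 2) \<longleftrightarrow> (even a \<longleftrightarrow> even b)" by presburger
  then have "k + of_nat (cox_length W S (w \<otimes> v)) + of_int ((a + b) mod 2) =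
    k + of_nat (cox_length W S v) + of_int b + of_nat (cox_length W S w) + of_int a"
    by (subst bit_eq_iff_zero)
      (simp only: bit_add_eq_0_iff of_nat_bit_eq_0_iff of_int_bit_eq_0_iff
        even_cox_length_mult[OF *(4,5)], blast)
  moreover have "\<phi> v x \<in> X" using * element_image by blast
  ultimately show "d\<phi> (g \<otimes>\<^bsub>W \<times>\<times> A1\<^esub> h) p = d\<phi> g (d\<phi> h p)"
    using * by (simp add: dc_action_eq composition_rule del: add_bit_eq_xor)
qed

lemma reflection_closed: "r \<in> reflections W S \<Longrightarrow> x \<in> X \<Longrightarrow> \<phi> r x \<in> X"
  using reflections_subset_carrier element_image by blast

lemma simple_action_self:
  assumes "s \<in> S" "x \<in> X" shows "\<phi> s (\<phi> s x) = x"
proof -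
  have "\<phi> s (\<phi> s x) = \<phi> \<one> x"
    using assms simple_closed composition_rule[of x s s] by (auto simp: simple_mult_self)
  then show ?thesis using one_action assms by simp
qed

lemma dc_action_reflection:
  assumes "r \<in> reflections W S" "x \<in> X"
  shows "d\<phi> (r, 0) (x, k) = (\<phi> r x, k + 1)"
proof -
  have "(of_nat (cox_length W S r) :: bit) = 1"
    using odd_cox_length_reflection[OF assms(1)] of_nat_bit_eq_0_iff bit_not_zero_iff by metis
  then show ?thesis
    using assms by (simp add: dc_action_eq del: add_bit_eq_xor)
qed

lemma dc_action_s0: "x \<in> X \<Longrightarrow> d\<phi> (\<one>, s0) (x, k) = (x, k + 1)"
  using of_nat_bit_eq_0_iff[of "cox_length W S \<one>"] even_cox_length_one
  by (simp add: dc_action_eq one_action del: add_bit_eq_xor)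

text \<open>If \<open>(w, a)\<close> fixes \<open>(x, k)\<close>, then the translation of
  \<open>k\<close> is zero, and this translation is the parity of the length of
  \<open>(w, a)\<close> in the product.\<close>

lemma dc_even_scaled_set: "even_scaled_set (W \<times>\<times> A1) dS dX d\<phi> dht"
proof -
  interpret G: group_action "W \<times>\<times> A1" dX d\<phi> by (rule dc_group_action)
  show ?thesis
  proof
    fix s p assume "s \<in> dS" "p \<in> dX"
    then obtain x k where p: "p = (x, k)" "x \<in> X" by (auto simp: dc_carrier_def)
    from \<open>s \<in> dS\<close> show "\<bar>dht (d\<phi> s p) - dht p\<bar> \<le> 1"
    proof (cases rule: simple_prod_cases)
      case (1 t)
      \<comment> \<open>The two values lie in \<open>{b, b + 1}\<close> and
        \<open>{a, a + 1}\<close> and have opposite parities. Their difference is odd and at most 2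
        in absolute value, hence 1.\<close>
      have "\<bar>(if even b \<longleftrightarrow> \<not> K then b else b + 1) - (if even a \<longleftrightarrow> K then a else a + 1)\<bar> \<le> 1"
        if "\<bar>b - a\<bar> \<le> 1" for a b :: int and K
        using that by (cases K) (simp; presburger)+
      from this[OF scaled[OF 1(1) p(2)], of "k = 0"] show ?thesis
        unfolding p(1) 1(2) one_integer_mod_group
          dc_action_reflection[OF simple_in_reflections[OF 1(1)] p(2)] dc_ht_eq[of ht x] dc_ht_add_1 .
    next
      case (2 t)
      then show ?thesis
        using p dc_action_s0[of x k]
        by (simp add: dc_ht_eq bit_add_eq_0_iff del: add_bit_eq_xor)
    qed
  next
    fix g p assume "g \<in> carrier (W \<times>\<times> A1)" "p \<in> dX" "d\<phi> g p = p"
    then obtain w a x k where *: "g = (w, a)" "p = (x, k)" "w \<in> carrier W" "a \<in> carrier A1"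
      "x \<in> X" "k + of_nat (cox_length W S w) + of_int a = k"
      by (auto simp: dc_carrier_def dc_action_eq simp del: add_bit_eq_xor)
    then have "(of_nat (cox_length W S w) + of_int a :: bit) = 0"
      by (simp only: add.assoc add_cancel_left_right)
    then have "even (cox_length W S w) \<longleftrightarrow> even a"
      by (simp only: bit_add_eq_0_iff of_nat_bit_eq_0_iff of_int_bit_eq_0_iff)
    moreover have "even (cox_length A1 {s0} a) \<longleftrightarrow> even a"
      using *(4) A.even_cox_length_one A.odd_cox_length_simple by (auto simp: carrier_A1)
    ultimately show "even (cox_length (W \<times>\<times> A1) dS g)"
      using P.even_cox_length_DirProd[of w a] * by simp
  qed
qed

section \<open>Transfer of the quasiparabolic axioms\<close>

interpretation E: even_scaled_set "W \<times>\<times> A1" dS dX d\<phi> dht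
  by (rule dc_even_scaled_set)

lemma reflections_dc:
  "reflections (W \<times>\<times> A1) dS = insert (\<one>, s0) ((\<lambda>r. (r, 0)) ` reflections W S)"
  using P.reflections_DirProd by (simp add: reflections_A1)

text \<open>Adding 1 to the bit raises the cover height only if \<open>k\<close> has the parity of
  the height below. So \<open>ht x\<close> and \<open>ht (\<phi> t x)\<close> have equal parity, and
  scaling lets them differ by at most 1.\<close>

lemma dc_ht_increase_imp_ht_eq:
  assumes "x \<in> X" "t \<in> S"
    and "dht (x, k) < dht (x, k + 1)" "dht (\<phi> t x, k) < dht (\<phi> t x, k + 1)"
  shows "ht (\<phi> t x) = ht x"
  using assms(3,4) scaled[OF assms(2,1)] unfolding dc_ht_add_1 dc_ht_eq
  by (cases "even (ht x)"; cases "even (ht (\<phi> t x))") (auto split: if_splits, presburger+)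

lemma quasiparabolic_imp_dc:
  assumes "quasiparabolic_set W S X \<phi> ht"
  shows "quasiparabolic_set (W \<times>\<times> A1) dS dX d\<phi> dht"
proof -
  interpret quasiparabolic_set W S X \<phi> ht by fact
  have add2: "k + 1 + 1 = k" for k :: bit
    by (cases k) auto
  have QP2_dc: "d\<phi> r p = d\<phi> s p"
    if r: "r \<in> reflections (W \<times>\<times> A1) dS" and "p \<in> dX" and s: "s \<in> dS"
      and lt: "dht p < dht (d\<phi> r p)" "dht (d\<phi> s (d\<phi> r p)) < dht (d\<phi> s p)" for r p s
  proof -
    obtain x k where p: "p = (x, k)" "x \<in> X" using \<open>p \<in> dX\<close> by (auto simp: dc_carrier_def)
    consider (s0s0) "r = (\<one>, s0)" "s = (\<one>, s0)"
      | (s0S) t where "r = (\<one>, s0)" "s = (t, 0)" "t \<in> S"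
      | (Rs0) q where "r = (q, 0)" "q \<in> reflections W S" "s = (\<one>, s0)"
      | (RS) q t where "r = (q, 0)" "q \<in> reflections W S" "s = (t, 0)" "t \<in> S"
      using r s by (auto simp: reflections_dc elim!: simple_prod_cases)
    then show ?thesis
    proof cases
      case s0s0
      then show ?thesis by simp
    next
      \<comment> \<open>As \<open>s0\<close> fixes the first coordinate, each inequality compares
        the two lifts of one point, first \<open>x\<close> and then
        \<open>\<phi> t x\<close>.\<close>
      case s0S
      note t = simple_in_reflections[OF s0S(3)]
      have "dht (x, k) < dht (x, k + 1)" "dht (\<phi> t x, k) < dht (\<phi> t x, k + 1)"
        using lt unfolding s0S p(1) dc_action_s0[OF p(2)] dc_action_reflection[OF t p(2)] add2 .
      then have "\<phi> t x = x"
        by (intro QP1[OF t p(2)] dc_ht_increase_imp_ht_eq[OF p(2) s0S(3)])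
      then show ?thesis
        using s0S p t by (simp add: dc_action_reflection dc_action_s0 del: add_bit_eq_xor)
    next
      \<comment> \<open>If \<open>k\<close> has the parity of \<open>ht x\<close>, the inequalities
        bound \<open>ht (\<phi> q x)\<close> by \<open>ht x\<close> from both sides; for the other
        parity they contradict each other.\<close>
      case Rs0
      have "\<phi> q x \<in> X" using p Rs0 reflection_closed by simp
      then have "ht (\<phi> q x) = ht x"
        using lt unfolding Rs0(1,3) p(1) dc_action_s0[OF p(2)] dc_action_reflection[OF Rs0(2) p(2)]
          dc_action_s0[OF \<open>\<phi> q x \<in> X\<close>] add2 dc_ht_add_1 dc_ht_eq
        by (simp split: if_splits)
      then have "\<phi> q x = x" using QP1 Rs0(2) p(2) by blast
      then show ?thesis
        using Rs0 p by (simp add: dc_action_reflection dc_action_s0 del: add_bit_eq_xor)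
    next
      case RS
      note t = simple_in_reflections[OF RS(4)]
      have X: "\<phi> q x \<in> X" "\<phi> t x \<in> X" using p RS t reflection_closed by auto
      have lt': "dht (x, k) < dht (\<phi> q x, k + 1)" "dht (\<phi> t (\<phi> q x), k) < dht (\<phi> t x, k + 1)"
        using lt unfolding RS(1,3) p(1) dc_action_reflection[OF RS(2) p(2)]
          dc_action_reflection[OF t p(2)] dc_action_reflection[OF t X(1)] add2 .
      \<comment> \<open>If \<open>q\<close> fixes \<open>x\<close>, the inequalities again compare
        lifts of single points, so (QP1) makes \<open>t\<close> fix \<open>x\<close> as
        well.\<close>
      have eq: "\<phi> q x = \<phi> t x" if "\<phi> q x = x"
        using QP1[OF t p(2) dc_ht_increase_imp_ht_eq[OF p(2) RS(4), of k]] lt' that by simp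
      \<comment> \<open>A cover height exceeds the height below by at most 1, so strict inequalities
        upstairs become weak ones downstairs: both are strict or one is an equality.\<close>
      have "ht x < ht (\<phi> q x) \<and> ht (\<phi> t (\<phi> q x)) < ht (\<phi> t x) \<or>
        ht (\<phi> q x) = ht x \<or> ht (\<phi> t (\<phi> q x)) = ht (\<phi> t x)"
        using lt' unfolding dc_ht_add_1 dc_ht_eq by (simp split: if_splits; linarith)
      then have "\<phi> q x = \<phi> t x"
      proof (elim disjE conjE)
        assume "ht x < ht (\<phi> q x)" "ht (\<phi> t (\<phi> q x)) < ht (\<phi> t x)"
        then show ?thesis using QP2 RS p by blast
      next
        assume "ht (\<phi> q x) = ht x"
        then show ?thesis using QP1 RS p eq by blast
      next
        assume same: "ht (\<phi> t (\<phi> q x)) = ht (\<phi> t x)"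
        have car: "t \<in> carrier W" "q \<in> carrier W"
          using t RS(2) reflections_subset_carrier by auto
        \<comment> \<open>Apply (QP1) to the conjugate reflection \<open>tqt\<close> at \<open>tx\<close>.\<close>
        have "\<phi> (t \<otimes> q \<otimes> t) (\<phi> t x) = \<phi> t (\<phi> q x)"
          using car X p simple_action_self[OF RS(4) p(2)] by (simp add: composition_rule)
        then have "\<phi> t (\<phi> q x) = \<phi> t x"
          using QP1[OF reflections_conj_simple[OF RS(2,4)] X(2)] same by simp
        then have "\<phi> q x = x"
          using simple_action_self[OF RS(4) X(1)] simple_action_self[OF RS(4) p(2)] by simp
        then show ?thesis by (rule eq)
      qed
      then show ?thesis
        using RS p t by (simp add: dc_action_reflection del: add_bit_eq_xor)
    qed
  qed
  have QP1_dc: "dht (d\<phi> r p) \<noteq> dht p"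
    if r: "r \<in> reflections (W \<times>\<times> A1) dS" and "p \<in> dX" for r p
  proof -
    obtain x k where p: "p = (x, k)" "x \<in> X" using \<open>p \<in> dX\<close> by (auto simp: dc_carrier_def)
    then obtain y where y: "d\<phi> r p = (y, k + 1)"
      using r by (auto simp: reflections_dc dc_action_reflection dc_action_s0 simp del: add_bit_eq_xor)
    \<comment> \<open>The left side is even exactly if \<open>K\<close> fails, the right side
      exactly if \<open>K\<close> holds.\<close>
    have "(if even b \<longleftrightarrow> \<not> K then b else b + 1) \<noteq> (if even a \<longleftrightarrow> K then a else a + 1)"
      for a b :: int and K
      by (cases K) (simp; presburger)+
    then show ?thesis unfolding p(1) y[unfolded p(1)] dc_ht_add_1 unfolding dc_ht_eq .
  qed
  show ?thesis
    by unfold_locales (use QP1_dc QP2_dc in blast)+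
qed

lemma dc_imp_quasiparabolic:
  assumes "quasiparabolic_set (W \<times>\<times> A1) dS dX d\<phi> dht"
  shows "quasiparabolic_set W S X \<phi> ht"
proof -
  interpret Q: quasiparabolic_set "W \<times>\<times> A1" dS dX d\<phi> dht by fact
  have lift: "(r, 0) \<in> reflections (W \<times>\<times> A1) dS" if "r \<in> reflections W S" for r
    using that by (simp add: reflections_dc)
  have simple: "(\<one>, s0) \<in> dS" "s \<in> S \<Longrightarrow> (s, 0) \<in> dS" for s
    by (simp_all add: simple_prod_def)
  have add2: "k + 1 + 1 = k" for k :: bit
    by (cases k) auto
  show ?thesis
  proof
    fix r x assume r: "r \<in> reflections W S" and x: "x \<in> X" and eq: "ht (\<phi> r x) = ht x"
    \<comment> \<open>At this lift the cover height is \<open>ht x\<close>, and \<open>s0\<close>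
      raises it to \<open>ht x + 1\<close>.\<close>
    let ?k = "of_int (ht x) :: bit"
    have "(x, ?k) \<in> dX" "\<phi> r x \<in> X"
      using x r reflection_closed by (auto simp: dc_carrier_def)
    \<comment> \<open>Since \<open>ht (\<phi> r x) = ht x\<close>, the lift of \<open>r\<close> also
      raises the height to \<open>ht x + 1\<close>, and a following \<open>s0\<close> lowers it
      again to \<open>ht x\<close>. These are the inequalities of (QP2) upstairs.\<close>
    then have "d\<phi> (r, 0) (x, ?k) = d\<phi> (\<one>, s0) (x, ?k)"
      using r x eq
      by (intro Q.QP2 lift simple)
        (auto simp: dc_action_reflection dc_action_s0 dc_ht_eq bit_add_eq_0_iff of_int_bit_eq_0_iff
          simp del: add_bit_eq_xor)
    then show "\<phi> r x = x"
      using r x by (simp add: dc_action_reflection dc_action_s0 del: add_bit_eq_xor)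
  next
    fix r x s assume r: "r \<in> reflections W S" and x: "x \<in> X" and s: "s \<in> S"
      and lt: "ht x < ht (\<phi> r x)" "ht (\<phi> s (\<phi> r x)) < ht (\<phi> s x)"
    let ?k = "of_int (ht x) :: bit"
    note t = simple_in_reflections[OF s]
    have X: "(x, ?k) \<in> dX" "\<phi> r x \<in> X"
      using x r reflection_closed by (auto simp: dc_carrier_def)
    \<comment> \<open>The chain \<open>ht x \<le> ht (\<phi> r x) - 1 \<le> ht (\<phi> s (\<phi> r
      x)) \<le> ht (\<phi> s x) - 1 \<le> ht x\<close> closes up, so all its terms are
      equal.\<close>
    have "ht (\<phi> r x) = ht x + 1" "ht (\<phi> s x) = ht x + 1" "ht (\<phi> s (\<phi> r x)) = ht x"
      using lt scaled[OF s x] scaled[OF s X(2)] by linarith+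
    then have "d\<phi> (r, 0) (x, ?k) = d\<phi> (s, 0) (x, ?k)"
      using r x X s t
      by (intro Q.QP2 lift simple)
        (auto simp: dc_action_reflection add2 dc_ht_eq bit_add_eq_0_iff of_int_bit_eq_0_iff
          simp del: add_bit_eq_xor)
    then show "\<phi> r x = \<phi> s x"
      using r x t by (simp add: dc_action_reflection del: add_bit_eq_xor)
  qed
qed

end

theorem theorem3p4:
  fixes W :: "('w, 'b) monoid_scheme" and S :: "'w set"
    and X :: "'x set" and \<phi> :: "'w \<Rightarrow> 'x \<Rightarrow> 'x" and ht :: "'x \<Rightarrow> int"
  assumes "coxeter_system W S" and "scaled_set W S X \<phi> ht"
  shows "even_scaled_set (W \<times>\<times> A1) (simple_prod W S A1 {s0})
           (dc_carrier X) (dc_action W S X \<phi>) (dc_ht ht)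
         \<and> (quasiparabolic_set (W \<times>\<times> A1) (simple_prod W S A1 {s0})
           (dc_carrier X) (dc_action W S X \<phi>) (dc_ht ht)
         \<longleftrightarrow> quasiparabolic_set W S X \<phi> ht)"
  using scaled_set.dc_even_scaled_set[OF assms(2)] scaled_set.quasiparabolic_imp_dc[OF assms(2)]
    scaled_set.dc_imp_quasiparabolic[OF assms(2)]
  by blast

end
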